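(* Consider the system $\partial_t\Phi+\partial_x\boldsymbol f(\Phi)=\boldsymbol 0$, $f_i(\Phi)=\phi_iv_i(\Phi)$, $i=1,\dots,N$, with velocity functions $v_i(\Phi)$ chosen such that there exists a function $w=w(\phi)$ satisfying properties (W1)--(W5) of the context (with associated $\boldsymbol\kappa$ and $\psi$). Consider the local Lax--Friedrichs (LLF) scheme defined by the marching formula $$\Phi_j^{n+1}=\Phi_j^n-\lambda_n\bigl(\boldsymbol{\mathcal F}^{\mathrm{LLF}}_{j+1/2}-\boldsymbol{\mathcal F}^{\mathrm{LLF}}_{j-1/2}\bigr),$$ where $$\boldsymbol{\mathcal F}^{\mathrm{LLF}}_{j+1/2}=\tfrac12\bigl(\boldsymbol f(\Phi_j^n)+\boldsymbol f(\Phi_{j+1}^n)-\alpha^n_{j+1/2}(\Phi_{j+1}^n-\Phi_j^n)\bigr),\qquad \alpha^n_{j+1/2}=\max\bigl\{|S_{\mathrm L,j+1/2}|,|S_{\mathrm R,j+1/2}|\bigr\},$$ $$S_{\mathrm L,j+1/2}=\min_{0\le s\le1}\tilde M_1\bigl(s\Phi_{j+1}^n+(1-s)\Phi_j^n\bigr),\qquad S_{\mathrm R,j+1/2}=\max_{0\le s\le1}M_2\bigl(s\Phi_{j+1}^n+(1-s)\Phi_j^n\bigr),$$ with $\tilde M_1(\Phi)=\psi(\phi)\,\boldsymbol\kappa^{\mathrm T}\Phi$ and $M_2(\Phi)$ the upper eigenvalue bound of the model under study (see context). If the CFL condition $$\alpha\lambda_n\le1,\qquad \alpha:=\max_j\bigl\{|S_{\mathrm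 L,j+1/2}|,|S_{\mathrm R,j+1/2}|\bigr\},$$ is in effect, then the LLF scheme satisfies the invariant region preservation property: for all $n=0,\dots,N_T-1$, if $\Phi_j^n\in\mathcal D_{\phi_{\max}}$ for all $j$, then $\Phi_j^{n+1}\in\mathcal D_{\phi_{\max}}$ for all $j$.
   Context: For $\Phi=(\phi_1,\dots,\phi_N)^{\mathrm T}$ write $\phi:=\phi_1+\dots+\phi_N$; $\phi_{\max}>0$ is a given maximum value and $$\mathcal D_{\phi_{\max}}:=\{\Phi\in\mathbb R^N:\ \phi_1\ge0,\dots,\phi_N\ge0,\ \phi\le\phi_{\max}\}.$$ The system is posed on $x\in[0,L]$, $t>0$, with $\boldsymbol f=(f_1,\dots,f_N)^{\mathrm T}$, and is assumed hyperbolic on $\mathcal D_{\phi_{\max}}$; $\lambda_1(\Phi)\ge\dots\ge\lambda_N(\Phi)$ are the eigenvalues of the Jacobian matrix of $\boldsymbol f$ at $\Phi\in\mathcal D_{\phi_{\max}}$. Properties of $w$: (W1) $w=w(\phi)$ is piecewise differentiable and $\sum_{i=1}^N\phi_iv_i(\Phi)=w(\phi)\,\boldsymbol\kappa^{\mathrm T}\Phi$, where $\boldsymbol\kappa=(\kappa_1,\dots,\kappa_N)^{\mathrm T}$ with parameters $\kappa_1\ge\dots\ge\kappa_N>0$. (W2) $w(\phi)\ge0$ for all $\phi\in[0,\phi_{\max}]$. (W3) $w(\phi_{\max})=0$. (W4) $w'$ is nondecreasing, i.e. $w'(\phi)\le w'(\tilde\phi)$ if $0\le\phi\le\tilde\phi\le\phi_{\max}$.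 (W5) There exists a piecewise continuous function $\psi(\phi)$ such that $\psi(\phi)\,\boldsymbol\kappa^{\mathrm T}\Phi\le\lambda_N(\Phi)$ and $w'(\phi)\ge\psi(\phi)$ for all $\Phi\in\mathcal D_{\phi_{\max}}$. Wave speed bounds. $S_{\mathrm L,j+1/2}$ and $S_{\mathrm R,j+1/2}$ play the role of lower and upper bounds for the eigenvalues at the interface $x_{j+1/2}$. The function $M_2$ is the upper eigenvalue bound belonging to the model under study, and is specified for two models: - Multiclass Lighthill--Whitham--Richards (MCLWR) traffic model: $v_i=\beta_iv(\phi)$, $\beta_1>\dots>\beta_N>0$, $v>0$ on $[0,\phi_{\max})$, $v(\phi_{\max})=0$, $v'\le0$, $v'$ nondecreasing; here $M_2(\Phi)=\beta_1v(\phi)$, $w=v$, $\boldsymbol\kappa=(\beta_1,\dots,\beta_N)^{\mathrm T}$, $\psi=v'$. - Masliyah--Lockett--Bassoon (MLB) polydisperse sedimentation model: $v_i(\Phi)=C(1-\phi)V(\phi)(\delta_i-\boldsymbol\delta^{\mathrm T}\Phi)$, $\boldsymbol\delta=(\delta_1,\dots,\delta_N)^{\mathrm T}$, $\delta_i=D_i^2/D_1^2$ with particle diameters $D_1>\dots>D_N$, $C$ a constant (proportional to the solid--fluid density difference), $V>0$ on $[0,\phi_{\max})$, $V(\phi_{\max})=0$, $V'\le0$; here $M_2(\Phi)=v_1(\Phi)$, $w(\phi)=C(1-\phi)^2V(\phi)$, $\boldsymbol\kappa=\boldsymbol\delta$, $\psi(\phi)=C[(1-\phi)V'(\phi)-2V(\phi)]$.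 Discretization. $[0,L]$ is divided into $M$ cells of width $\Delta x=L/M$, indexed by $j=0,\dots,M-1$, cell $j$ having interfaces $x_{j-1/2}$ and $x_{j+1/2}$; $\Delta t_n$, $n=0,\dots,N_T-1$, are the time steps and $\lambda_n:=\Delta t_n/\Delta x$. $\Phi_j^n$ is the numerical solution in cell $j$ at time level $n$. Boundary conditions are either periodic (all indices $j$ understood modulo $M$, so the fluxes at interfaces $-1/2$ and $M-1/2$ coincide) or zero-flux (the fluxes at interfaces $-1/2$ and $M-1/2$ are set to $\boldsymbol 0$).
   Formalization: The upper eigenvalue bound M_2 is specified only for the MCLWR and MLB models, and the claim fails for a general bound M_2 ≥ λ_1; the formal theorem therefore takes the velocities, M_2, w, κ and ψ to be those of one of these two models. *)

theory Defs
  imports "HOL-Analysis.Analysis"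
begin

(* Species are indexed by a finite linearly ordered type 'n, whose i-th smallest element plays
   the role of the index i; N = CARD('n). *)

definition first_ix :: "'n::{finite,linorder}" where
  "first_ix = Min UNIV"

definition last_ix :: "'n::{finite,linorder}" where
  "last_ix = Max UNIV"

definition total_conc :: "real ^ 'n \<Rightarrow> real" where
  "total_conc \<Phi> = (\<Sum>i\<in>UNIV. \<Phi> $ i)"

definition inv_region :: "real \<Rightarrow> (real ^ 'n) set" where
  "inv_region \<phi>max = {\<Phi>. (\<forall>i. \<Phi> $ i \<ge> 0) \<and> total_conc \<Phi> \<le> \<phi>max}"

definition flux :: "(real ^ 'n \<Rightarrow> real ^ 'n) \<Rightarrow> real ^ 'n \<Rightarrow> real ^ 'n" where
  "flux v \<Phi> = (\<chi> i. \<Phi> $ i * v \<Phi> $ i)"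

(* g' is the derivative of the piecewise differentiable function g. At the finitely many points
   where g has no derivative, g' carries some value that is fixed by convention (for instance a
   one-sided derivative); nothing is required of it here. At the end points of the interval the
   derivative is one-sided. *)
definition pw_derivative :: "real \<Rightarrow> (real \<Rightarrow> real) \<Rightarrow> (real \<Rightarrow> real) \<Rightarrow> bool" where
  "pw_derivative b g g' \<longleftrightarrow>
     g piecewise_differentiable_on {0..b} \<and>
     (\<forall>x\<in>{0..b}. g differentiable (at x within {0..b}) \<longrightarrow>
        (g has_real_derivative g' x) (at x within {0..b}))"

definition pw_continuous :: "real \<Rightarrow> (real \<Rightarrow> real) \<Rightarrow> bool" where
  "pw_continuous b g \<longleftrightarrow>
     (\<exists>S. finite S \<and>
        (\<forall>x\<in>{0..b} - S. continuous (at x within {0..b}) g) \<and>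
        (\<forall>x\<in>S \<inter> {0..b}.
           (\<exists>l. (g \<longlongrightarrow> l) (at x within {0..<x})) \<and>
           (\<exists>r. (g \<longlongrightarrow> r) (at x within {x<..b}))))"

(* All eigenvalues of the Jacobian matrix are real; lam \<Phi> lists them in nonincreasing order and
   with multiplicity, i.e. as the roots of the characteristic polynomial. Since w is only
   piecewise differentiable, f may have no Jacobian matrix at some states; there the sorted
   vector lam \<Phi> is a convention, like g' above. Derivatives are taken relative to the region,
   which has interior points near each of its points, so they are unique. *)
definition hyperbolic_with_eigenvalues ::
  "(real ^ 'n::{finite,linorder}) set \<Rightarrow>
   (real ^ 'n::{finite,linorder} \<Rightarrow> real ^ 'n::{finite,linorder}) \<Rightarrow>
   (real ^ 'n::{finite,linorder} \<Rightarrow> real ^ 'n::{finite,linorder}) \<Rightarrow> bool"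
where
  "hyperbolic_with_eigenvalues D f lam \<longleftrightarrow>
     (\<forall>\<Phi>\<in>D. antimono (($) (lam \<Phi>)) \<and>
        (f differentiable (at \<Phi> within D) \<longrightarrow>
           (\<forall>x. det (mat x - jacobian f (at \<Phi> within D)) = (\<Prod>i\<in>UNIV. x - lam \<Phi> $ i))))"

definition mclwr_model ::
  "real \<Rightarrow> (real ^ 'n::{finite,linorder} \<Rightarrow> real ^ 'n::{finite,linorder}) \<Rightarrow>
   (real ^ 'n::{finite,linorder} \<Rightarrow> real) \<Rightarrow> (real \<Rightarrow> real) \<Rightarrow> real ^ 'n::{finite,linorder} \<Rightarrow>
   (real \<Rightarrow> real) \<Rightarrow> bool" where
  "mclwr_model \<phi>max v M2 w \<kappa> \<psi> \<longleftrightarrow>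
     (\<exists>\<beta> u u'.
        (\<forall>i. \<beta> $ i > 0) \<and> strict_antimono_on UNIV (($) \<beta>) \<and>
        pw_derivative \<phi>max u u' \<and>
        (\<forall>x\<in>{0..<\<phi>max}. u x > 0) \<and> u \<phi>max = 0 \<and>
        (\<forall>x\<in>{0..\<phi>max}. u' x \<le> 0) \<and> mono_on {0..\<phi>max} u' \<and>
        (\<forall>\<Phi>\<in>inv_region \<phi>max. \<forall>i. v \<Phi> $ i = \<beta> $ i * u (total_conc \<Phi>)) \<and>
        (\<forall>\<Phi>\<in>inv_region \<phi>max. M2 \<Phi> = \<beta> $ first_ix * u (total_conc \<Phi>)) \<and>
        \<kappa> = \<beta> \<and>
        (\<forall>x\<in>{0..\<phi>max}. w x = u x \<and> \<psi> x = u' x))"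

definition mlb_model ::
  "real \<Rightarrow> (real ^ 'n::{finite,linorder} \<Rightarrow> real ^ 'n::{finite,linorder}) \<Rightarrow>
   (real ^ 'n::{finite,linorder} \<Rightarrow> real) \<Rightarrow> (real \<Rightarrow> real) \<Rightarrow> real ^ 'n::{finite,linorder} \<Rightarrow>
   (real \<Rightarrow> real) \<Rightarrow> bool" where
  "mlb_model \<phi>max v M2 w \<kappa> \<psi> \<longleftrightarrow>
     (\<exists>d \<delta> C V V'.
        (\<forall>i. d $ i > 0) \<and> strict_antimono_on UNIV (($) d) \<and>
        (\<forall>i. \<delta> $ i = (d $ i)\<^sup>2 / (d $ first_ix)\<^sup>2) \<and>
        pw_derivative \<phi>max V V' \<and>
        (\<forall>x\<in>{0..<\<phi>max}. V x > 0) \<and> V \<phi>max = 0 \<and>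
        (\<forall>x\<in>{0..\<phi>max}. V' x \<le> 0) \<and>
        (\<forall>\<Phi>\<in>inv_region \<phi>max. \<forall>i.
           v \<Phi> $ i = C * (1 - total_conc \<Phi>) * V (total_conc \<Phi>) * (\<delta> $ i - \<delta> \<bullet> \<Phi>)) \<and>
        (\<forall>\<Phi>\<in>inv_region \<phi>max. M2 \<Phi> = v \<Phi> $ first_ix) \<and>
        \<kappa> = \<delta> \<and>
        (\<forall>x\<in>{0..\<phi>max}. w x = C * (1 - x)\<^sup>2 * V x \<and>
           \<psi> x = C * ((1 - x) * V' x - 2 * V x)))"

definition M1_tilde :: "(real \<Rightarrow> real) \<Rightarrow> real ^ 'n \<Rightarrow> real ^ 'n \<Rightarrow> real" where
  "M1_tilde \<psi> \<kappa> \<Phi> = \<psi> (total_conc \<Phi>) * (\<kappa> \<bullet> \<Phi>)"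

(* Infimum and supremum instead of minimum and maximum: \<psi> is only piecewise continuous, so the
   minimum need not be attained. *)
definition S_L :: "(real ^ 'n \<Rightarrow> real) \<Rightarrow> real ^ 'n \<Rightarrow> real ^ 'n \<Rightarrow> real" where
  "S_L M1 \<Phi>l \<Phi>r = (INF s\<in>{0..1}. M1 (s *\<^sub>R \<Phi>r + (1 - s) *\<^sub>R \<Phi>l))"

definition S_R :: "(real ^ 'n \<Rightarrow> real) \<Rightarrow> real ^ 'n \<Rightarrow> real ^ 'n \<Rightarrow> real" where
  "S_R M2 \<Phi>l \<Phi>r = (SUP s\<in>{0..1}. M2 (s *\<^sub>R \<Phi>r + (1 - s) *\<^sub>R \<Phi>l))"

definition viscosity ::
  "(real ^ 'n \<Rightarrow> real) \<Rightarrow> (real ^ 'n \<Rightarrow> real) \<Rightarrow> real ^ 'n \<Rightarrow> real ^ 'n \<Rightarrow> real" where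
  "viscosity M1 M2 \<Phi>l \<Phi>r = max \<bar>S_L M1 \<Phi>l \<Phi>r\<bar> \<bar>S_R M2 \<Phi>l \<Phi>r\<bar>"

definition llf_flux ::
  "(real ^ 'n \<Rightarrow> real ^ 'n) \<Rightarrow> (real ^ 'n \<Rightarrow> real) \<Rightarrow> (real ^ 'n \<Rightarrow> real) \<Rightarrow>
   real ^ 'n \<Rightarrow> real ^ 'n \<Rightarrow> real ^ 'n" where
  "llf_flux f M1 M2 \<Phi>l \<Phi>r =
     (1 / 2) *\<^sub>R (f \<Phi>l + f \<Phi>r - viscosity M1 M2 \<Phi>l \<Phi>r *\<^sub>R (\<Phi>r - \<Phi>l))"

datatype boundary = Periodic | Zero_Flux

(* Interface number k, 0 \<le> k \<le> M, is the point x_(k - 1/2) = k \<Delta>x, between cells k - 1 and k.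
   The set below contains the interfaces at which the LLF flux is used. *)
definition llf_interfaces :: "boundary \<Rightarrow> nat \<Rightarrow> nat set" where
  "llf_interfaces bc M = (case bc of Periodic \<Rightarrow> {0..M} | Zero_Flux \<Rightarrow> {0<..<M})"

definition left_cell :: "nat \<Rightarrow> nat \<Rightarrow> nat" where
  "left_cell M k = (if k = 0 then M - 1 else k - 1)"

definition right_cell :: "nat \<Rightarrow> nat \<Rightarrow> nat" where
  "right_cell M k = (if k = M then 0 else k)"

definition interface_flux ::
  "boundary \<Rightarrow> nat \<Rightarrow> (real ^ 'n \<Rightarrow> real ^ 'n) \<Rightarrow> (real ^ 'n \<Rightarrow> real) \<Rightarrow> (real ^ 'n \<Rightarrow> real) \<Rightarrow>
   (nat \<Rightarrow> real ^ 'n) \<Rightarrow> nat \<Rightarrow> real ^ 'n" where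
  "interface_flux bc M f M1 M2 U k =
     (if k \<in> llf_interfaces bc M
      then llf_flux f M1 M2 (U (left_cell M k)) (U (right_cell M k)) else 0)"

(* The element 0 does not change the maximum of the nonnegative interface speeds; it covers the
   case M = 1 with zero-flux conditions, in which there is no LLF interface. *)
definition max_speed ::
  "boundary \<Rightarrow> nat \<Rightarrow> (real ^ 'n \<Rightarrow> real) \<Rightarrow> (real ^ 'n \<Rightarrow> real) \<Rightarrow> (nat \<Rightarrow> real ^ 'n) \<Rightarrow> real" where
  "max_speed bc M M1 M2 U =
     Max (insert 0 ((\<lambda>k. viscosity M1 M2 (U (left_cell M k)) (U (right_cell M k)))
                    ` llf_interfaces bc M))"

end

(* Write a for the viscosity at an interface and f for the flux. The update of a cell is a convex
   combination of its old state and of vectors (a P - f P) / a and (a P + f P) / a, where P is a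
   neighbouring state; to allow a = 0 these are kept unscaled, as members of the region with bound
   a phimax. They lie in that region for two reasons. First, every velocity at P is bounded in
   modulus by a, which gives nonnegative components. Second, w is convex and vanishes at phimax,
   so that w(phi) <= -(phimax - phi) w'(phi) <= -(phimax - phi) psi(phi), which bounds the total
   concentration of a P + f P by a phimax. In the MLB model convexity of w also excludes
   phimax > 1 unless C = 0; this fixes the sign of the factor 1 - phi in the velocities. *)

theory Submission
  imports Defs
begin

section \<open>Piecewise differentiable and piecewise continuous functions of one variable\<close>

text \<open>The increment of g is the integral of \<open>g'\<close>, and a monotone integrand lies
  between its end values. These are the tangent inequalities of convexity; they remain valid at
  kinks of g, whatever values \<open>g'\<close> takes there, as long as \<open>g'\<close> is
  monotone.\<close>

lemma pw_derivative_mono_bounds: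
  assumes g: "pw_derivative b g g'" and mono: "mono_on {0..b} g'"
    and xy: "0 \<le> x" "x \<le> y" "y \<le> b"
  shows "(y - x) * g' x \<le> g y - g x" "g y - g x \<le> (y - x) * g' y"
proof -
  from g obtain S where cont: "continuous_on {0..b} g" and S: "finite S"
    and diff: "\<And>z. z \<in> {0..b} - S \<Longrightarrow> g differentiable (at z within {0..b})"
    and der: "\<And>z. z \<in> {0..b} \<Longrightarrow> g differentiable (at z within {0..b}) \<Longrightarrow>
        (g has_real_derivative g' z) (at z within {0..b})"
    unfolding pw_derivative_def piecewise_differentiable_on_def by blast
  have "(g has_vector_derivative g' z) (at z)" if "z \<in> {x<..<y} - S" for z
  proof -
    have "z \<in> interior {0..b}" using that xy by auto
    then have "at z within {0..b} = at z" by (rule at_within_interior)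
    moreover have "(g has_real_derivative g' z) (at z within {0..b})"
      using that xy by (intro der diff) auto
    ultimately show ?thesis
      by (simp add: has_real_derivative_iff_has_vector_derivative)
  qed
  \<comment> \<open>This form of the fundamental theorem tolerates the finite exceptional set S and
    asks only for continuity of g there.\<close>
  then have int: "(g' has_integral (g y - g x)) {x..y}"
    using S xy by (intro fundamental_theorem_of_calculus_interior_strong[where S = S]
        continuous_on_subset[OF cont]) auto
  have const: "((\<lambda>_. c) has_integral (y - x) * c) {x..y}" for c :: real
    using has_integral_const_real[of c x y] xy by simp
  show "(y - x) * g' x \<le> g y - g x"
    by (rule has_integral_le[OF const int]) (use xy mono in \<open>auto intro: mono_onD\<close>)
  show "g y - g x \<le> (y - x) * g' y"
    by (rule has_integral_le[OF int const]) (use xy mono in \<open>auto intro: mono_onD\<close>)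
qed

text \<open>One-sided limits bound g on a punctured neighbourhood of each point; bisection turns
  these local bounds into a global one. The bound ensures that the infimum defining
  \<open>S_L\<close> is a true lower bound.\<close>

lemma pw_continuous_bounded:
  assumes g: "pw_continuous b g"
  obtains B where "\<And>x. x \<in> {0..b} \<Longrightarrow> \<bar>g x\<bar> \<le> B"
proof -
  from g obtain S where
    cont: "\<And>x. x \<in> {0..b} - S \<Longrightarrow> continuous (at x within {0..b}) g" and
    lim: "\<And>x. x \<in> S \<inter> {0..b} \<Longrightarrow> (\<exists>l. (g \<longlongrightarrow> l) (at x within {0..<x})) \<and>
           (\<exists>r. (g \<longlongrightarrow> r) (at x within {x<..b}))"
    unfolding pw_continuous_def by blast
  have ev: "\<exists>B. \<forall>\<^sub>F y in F. \<bar>g y\<bar> \<le> B" if "(g \<longlongrightarrow> l) F" for l F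
  proof -
    have "\<forall>\<^sub>F y in F. dist (g y) l < 1" using that by (rule tendstoD) simp
    then have "\<forall>\<^sub>F y in F. \<bar>g y\<bar> \<le> \<bar>l\<bar> + 1"
      by eventually_elim (auto simp: dist_real_def)
    then show ?thesis by blast
  qed
  have loc: "\<exists>B. \<forall>\<^sub>F y in at x within {0..b}. \<bar>g y\<bar> \<le> B" if x: "x \<in> {0..b}" for x
  proof (cases "x \<in> S")
    case False
    then have "(g \<longlongrightarrow> g x) (at x within {0..b})"
      using cont x by (simp add: continuous_within)
    then show ?thesis by (rule ev)
  next
    case True
    then obtain B1 B2 where "\<forall>\<^sub>F y in at x within {0..<x}. \<bar>g y\<bar> \<le> B1"
      "\<forall>\<^sub>F y in at x within {x<..b}. \<bar>g y\<bar> \<le> B2"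
      using lim[of x] x ev by blast
    then have "\<forall>\<^sub>F y in at x within {0..<x}. \<bar>g y\<bar> \<le> max B1 B2"
      "\<forall>\<^sub>F y in at x within {x<..b}. \<bar>g y\<bar> \<le> max B1 B2"
      by (auto elim: eventually_mono)
    \<comment> \<open>The two sides together form a punctured neighbourhood of x, also at the end
      points, where one side is empty.\<close>
    then have "\<forall>\<^sub>F y in at x within {0..<x} \<union> {x<..b}. \<bar>g y\<bar> \<le> max B1 B2"
      by (simp add: at_within_union eventually_sup)
    moreover have "{0..<x} \<union> {x<..b} = {0..b} - {x}" using x by auto
    ultimately have "\<forall>\<^sub>F y in at x within {0..b} - {x}. \<bar>g y\<bar> \<le> max B1 B2" by simp
    then have "\<forall>\<^sub>F y in at x within {0..b}. \<bar>g y\<bar> \<le> max B1 B2"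
      by (simp add: at_within_def)
    then show ?thesis by blast
  qed
  \<comment> \<open>Bolzano's rule tests small intervals that may stick out of [0, b], hence the
    intersection in the property.\<close>
  have "\<exists>B. \<forall>y\<in>{0..b} \<inter> {0..b}. \<bar>g y\<bar> \<le> B" if "0 \<le> b"
    using that
  proof (rule Bolzano[where P = "\<lambda>p q. \<exists>B. \<forall>y\<in>{p..q} \<inter> {0..b}. \<bar>g y\<bar> \<le> B"])
    fix p q r
    assume "\<exists>B. \<forall>y\<in>{p..q} \<inter> {0..b}. \<bar>g y\<bar> \<le> B" "\<exists>B. \<forall>y\<in>{q..r} \<inter> {0..b}. \<bar>g y\<bar> \<le> B"
    then obtain B1 B2 where "\<forall>y\<in>{p..q} \<inter> {0..b}. \<bar>g y\<bar> \<le> B1"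
      "\<forall>y\<in>{q..r} \<inter> {0..b}. \<bar>g y\<bar> \<le> B2" by blast
    then have "\<forall>y\<in>{p..r} \<inter> {0..b}. \<bar>g y\<bar> \<le> max B1 B2" by (force simp: le_max_iff_disj)
    then show "\<exists>B. \<forall>y\<in>{p..r} \<inter> {0..b}. \<bar>g y\<bar> \<le> B" by blast
  next
    fix x assume "0 \<le> x" "x \<le> b"
    then obtain B where "\<forall>\<^sub>F y in at x within {0..b}. \<bar>g y\<bar> \<le> B" using loc by auto
    then obtain d where d: "d > 0"
      "\<And>y. y \<in> {0..b} \<Longrightarrow> y \<noteq> x \<Longrightarrow> dist y x < d \<Longrightarrow> \<bar>g y\<bar> \<le> B"
      unfolding eventually_at by blast
    \<comment> \<open>The filter bound does not cover x itself, so its value enters the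
      maximum.\<close>
    have "\<forall>y\<in>{p..q} \<inter> {0..b}. \<bar>g y\<bar> \<le> max B \<bar>g x\<bar>"
      if "p \<le> x \<and> x \<le> q \<and> q - p < d" for p q
    proof
      fix y assume "y \<in> {p..q} \<inter> {0..b}"
      then show "\<bar>g y\<bar> \<le> max B \<bar>g x\<bar>"
        using that d(2)[of y] by (cases "y = x") (auto simp: dist_real_def le_max_iff_disj)
    qed
    with d(1) show "\<exists>d>0. \<forall>p q. p \<le> x \<and> x \<le> q \<and> q - p < d \<longrightarrow>
        (\<exists>B. \<forall>y\<in>{p..q} \<inter> {0..b}. \<bar>g y\<bar> \<le> B)" by blast
  qed
  then have "\<exists>B. \<forall>y\<in>{0..b}. \<bar>g y\<bar> \<le> B" by (cases "0 \<le> b") simp_all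
  then show ?thesis using that by blast
qed

section \<open>Total concentration and the invariant region\<close>

lemma total_conc_add: "total_conc (P + Q) = total_conc P + total_conc Q"
  by (simp add: total_conc_def sum.distrib)

lemma total_conc_diff: "total_conc (P - Q) = total_conc P - total_conc Q"
  by (simp add: total_conc_def sum_subtractf)

lemma total_conc_scaleR: "total_conc (c *\<^sub>R P) = c * total_conc P"
  by (simp add: total_conc_def sum_distrib_left)

lemma total_conc_inv_region: "P \<in> inv_region m \<Longrightarrow> total_conc P \<in> {0..m}"
  by (auto simp: inv_region_def total_conc_def intro: sum_nonneg)

lemma convex_inv_region: "convex (inv_region m)"
proof (rule convexI)
  fix P Q :: "real ^ 'n" and s t :: real
  assume *: "P \<in> inv_region m" "Q \<in> inv_region m" "0 \<le> s" "0 \<le> t" "s + t = 1"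
  then have "total_conc (s *\<^sub>R P + t *\<^sub>R Q) \<le> m"
    using convex_bound_le[of "total_conc P" m "total_conc Q" s t]
    by (simp add: inv_region_def total_conc_add total_conc_scaleR)
  with * show "s *\<^sub>R P + t *\<^sub>R Q \<in> inv_region m"
    by (simp add: inv_region_def)
qed

lemma inner_inv_region_bounds:
  fixes \<kappa> :: "real ^ 'n::{finite,linorder}"
  assumes "antimono (($) \<kappa>)" "\<forall>i. \<kappa> $ i > 0" "P \<in> inv_region m"
  shows "0 \<le> \<kappa> \<bullet> P" "\<kappa> \<bullet> P \<le> \<kappa> $ first_ix * m"
proof -
  have P: "P $ i \<ge> 0" for i using assms(3) by (simp add: inv_region_def)
  show "0 \<le> \<kappa> \<bullet> P"
    unfolding inner_vec_def using assms(2) P by (auto intro!: sum_nonneg simp: less_imp_le)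
  have "\<kappa> \<bullet> P \<le> (\<Sum>i\<in>UNIV. \<kappa> $ first_ix * P $ i)"
    unfolding inner_vec_def
    by (auto intro!: sum_mono mult_right_mono P antimonoD[OF assms(1)] simp: first_ix_def)
  also have "\<dots> = \<kappa> $ first_ix * total_conc P"
    by (simp add: total_conc_def sum_distrib_left)
  also have "\<dots> \<le> \<kappa> $ first_ix * m"
    using assms(2,3) by (auto simp: inv_region_def intro!: mult_left_mono less_imp_le)
  finally show "\<kappa> \<bullet> P \<le> \<kappa> $ first_ix * m" .
qed

section \<open>Velocity bounds in the two models\<close>

text \<open>The common factor u is nonnegative and the first coefficient is the largest. As no
  velocity is negative, \<open>M2\<close> alone bounds the moduli.\<close>

lemma mclwr_velocity_bounds:
  assumes model: "mclwr_model m v M2 w \<kappa> \<psi>" and P: "P \<in> inv_region m"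
  shows "v P $ i \<le> M2 P" "0 \<le> v P $ i"
proof -
  obtain \<beta> u u' where \<beta>: "\<And>i. \<beta> $ i > 0" "strict_antimono_on UNIV (($) \<beta>)"
    and u: "\<And>x. x \<in> {0..<m} \<Longrightarrow> u x > 0" "u m = 0"
    and v: "\<And>i. v P $ i = \<beta> $ i * u (total_conc P)"
    and M2: "M2 P = \<beta> $ first_ix * u (total_conc P)"
    using model P unfolding mclwr_model_def by blast
  have "u (total_conc P) \<ge> 0"
    using u(1)[of "total_conc P"] u(2) total_conc_inv_region[OF P]
    by (cases "total_conc P = m") auto
  moreover have "\<beta> $ i \<le> \<beta> $ first_ix"
  proof (cases "i = first_ix")
    case False
    then have "first_ix < i" by (simp add: first_ix_def order.not_eq_order_implies_strict)
    then show ?thesis using monotone_onD[OF \<beta>(2)] by fastforce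
  qed simp
  ultimately show "v P $ i \<le> M2 P" "0 \<le> v P $ i"
    using \<beta>(1)[of i] by (auto simp: v M2 intro: mult_right_mono)
qed

lemma mclwr_M2_bdd_above:
  assumes "mclwr_model m v M2 w \<kappa> \<psi>"
  shows "bdd_above (M2 ` inv_region m)"
proof -
  obtain u u' where u: "pw_derivative m u u'"
    and M2: "\<forall>P\<in>inv_region m. M2 P = \<kappa> $ first_ix * u (total_conc P)"
    using assms unfolding mclwr_model_def by blast
  have "continuous_on {0..m} u"
    using u by (simp add: pw_derivative_def piecewise_differentiable_on_def)
  then have "bdd_above ((\<lambda>x. \<kappa> $ first_ix * u x) ` {0..m})"
    by (intro bounded_imp_bdd_above compact_imp_bounded compact_continuous_image
        continuous_intros) auto
  then show ?thesis
    by (rule bdd_above_mono) (use M2 total_conc_inv_region in blast)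
qed

text \<open>The sign of C is read off at 0, where (W2) gives C V(0) >= 0 while V(0) > 0. If C > 0
  and m > 1, then w would vanish at 1 and at m and be positive in between, which monotonicity of
  \<open>w'\<close> forbids. The remaining conclusions pass on the model data.\<close>

lemma mlb_coefficient_nonneg:
  assumes model: "mlb_model m v M2 w \<kappa> \<psi>" and m: "m > 0"
    and w: "pw_derivative m w w'" "mono_on {0..m} w'" "\<forall>x\<in>{0..m}. w x \<ge> 0" "w m = 0"
  obtains C V V' where
    "continuous_on {0..m} V" "\<And>x. x \<in> {0..m} \<Longrightarrow> V x \<ge> 0" "\<And>x. x \<in> {0..m} \<Longrightarrow> V' x \<le> 0"
    "\<And>P i. P \<in> inv_region m \<Longrightarrow>
       v P $ i = C * (1 - total_conc P) * V (total_conc P) * (\<kappa> $ i - \<kappa> \<bullet> P)"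
    "\<And>P. P \<in> inv_region m \<Longrightarrow> M2 P = v P $ first_ix"
    "\<And>x. x \<in> {0..m} \<Longrightarrow> \<psi> x = C * ((1 - x) * V' x - 2 * V x)"
    "C \<ge> 0" "C = 0 \<or> m \<le> 1"
proof -
  obtain C V V' where
    V: "pw_derivative m V V'" "\<And>x. x \<in> {0..<m} \<Longrightarrow> V x > 0" "V m = 0"
      "\<And>x. x \<in> {0..m} \<Longrightarrow> V' x \<le> 0"
    and v: "\<And>P i. P \<in> inv_region m \<Longrightarrow>
       v P $ i = C * (1 - total_conc P) * V (total_conc P) * (\<kappa> $ i - \<kappa> \<bullet> P)"
       "\<And>P. P \<in> inv_region m \<Longrightarrow> M2 P = v P $ first_ix"
    and weq: "\<And>x. x \<in> {0..m} \<Longrightarrow> w x = C * (1 - x)\<^sup>2 * V x"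
    and \<psi>: "\<And>x. x \<in> {0..m} \<Longrightarrow> \<psi> x = C * ((1 - x) * V' x - 2 * V x)"
    using model unfolding mlb_model_def by (elim exE conjE) (rule that; blast)
  have cont: "continuous_on {0..m} V"
    using V(1) by (simp add: pw_derivative_def piecewise_differentiable_on_def)
  have Vnn: "V x \<ge> 0" if "x \<in> {0..m}" for x
    using V(2)[of x] V(3) that by (cases "x = m") auto
  have "C * V 0 \<ge> 0" using bspec[OF w(3), of 0] weq[of 0] m by simp
  then have C: "C \<ge> 0" using V(2)[of 0] m by (simp add: zero_le_mult_iff)
  have "C = 0 \<or> m \<le> 1"
  proof (rule ccontr)
    assume "\<not> ?thesis"
    then have "C > 0" "m > 1" using C by auto
    \<comment> \<open>At this point between the zeros 1 and m of w, the tangent inequality towards m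
      forces \<open>w' x < 0\<close>, and the one towards 1 forces \<open>w' x > 0\<close>.\<close>
    define x where "x = (1 + m) / 2"
    have x: "1 < x" "x < m" using \<open>m > 1\<close> by (auto simp: x_def)
    then have pos: "w x > 0" using weq[of x] V(2)[of x] \<open>C > 0\<close> by auto
    have "(m - x) * w' x \<le> - w x"
      using pw_derivative_mono_bounds(1)[OF w(1,2), of x m] x w(4) by simp
    then have "(m - x) * w' x < 0" using pos by linarith
    then have "w' x < 0" using x by (simp add: mult_less_0_iff)
    moreover have "w x - w 1 \<le> (x - 1) * w' x"
      using pw_derivative_mono_bounds(2)[OF w(1,2), of 1 x] x by simp
    moreover have "w 1 = 0" using weq[of 1] \<open>m > 1\<close> by simp
    ultimately show False using pos x mult_pos_neg[of "x - 1" "w' x"] by linarith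
  qed
  with that[OF cont Vnn V(4) v \<psi> C] show ?thesis by blast
qed

text \<open>With the prefactor C (1 - x) V(x) >= 0, the velocity is largest for the first species.
  Dropping the term with \<open>\<kappa> $ i\<close> bounds its negative by the prefactor times the
  inner product of kappa and P, and the prefactor is at most -psi.\<close>

lemma mlb_velocity_bounds:
  assumes model: "mlb_model m v M2 w \<kappa> \<psi>" and m: "m > 0"
    and w: "pw_derivative m w w'" "mono_on {0..m} w'" "\<forall>x\<in>{0..m}. w x \<ge> 0" "w m = 0"
    and P: "P \<in> inv_region m"
    and \<kappa>: "antimono (($) \<kappa>)" "\<forall>i. \<kappa> $ i > 0"
  shows "v P $ i \<le> M2 P" "- v P $ i \<le> - M1_tilde \<psi> \<kappa> P"
proof -
  obtain C V V' where V: "\<And>x. x \<in> {0..m} \<Longrightarrow> V x \<ge> 0" "\<And>x. x \<in> {0..m} \<Longrightarrow> V' x \<le> 0"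
    and v: "\<And>i. v P $ i = C * (1 - total_conc P) * V (total_conc P) * (\<kappa> $ i - \<kappa> \<bullet> P)"
    and M2: "M2 P = v P $ first_ix"
    and \<psi>: "\<And>x. x \<in> {0..m} \<Longrightarrow> \<psi> x = C * ((1 - x) * V' x - 2 * V x)"
    and C: "C \<ge> 0" "C = 0 \<or> m \<le> 1"
    using mlb_coefficient_nonneg[OF model m w] P by metis
  define x where "x = total_conc P"
  have x: "x \<in> {0..m}" using total_conc_inv_region[OF P] by (simp add: x_def)
  have Cx: "C * (1 - x) \<ge> 0" using C x by (auto intro: mult_nonneg_nonneg)
  have CV: "C * (1 - x) * V x \<ge> 0" using Cx V(1)[OF x] by (rule mult_nonneg_nonneg)
  have "\<kappa> $ i \<le> \<kappa> $ first_ix" using antimonoD[OF \<kappa>(1), of first_ix i] by (simp add: first_ix_def)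
  then show "v P $ i \<le> M2 P"
    unfolding M2 v x_def[symmetric] using CV by (intro mult_left_mono) auto
  have \<kappa>P: "\<kappa> \<bullet> P \<ge> 0" by (rule inner_inv_region_bounds(1)[OF \<kappa> P])
  \<comment> \<open>The difference of -psi(x) and the prefactor is C V(x) (1 + x) - C (1 - x) V'(x);
    both terms contribute nonnegatively.\<close>
  have "C * (1 - x) * V' x \<le> 0" using Cx V(2)[OF x] by (rule mult_nonneg_nonpos)
  moreover have "C * V x * (1 + x) \<ge> 0" using C V(1)[OF x] x by simp
  ultimately have "C * (1 - x) * V x \<le> - \<psi> x"
    unfolding \<psi>[OF x] by (simp add: algebra_simps)
  then have "C * (1 - x) * V x * (\<kappa> \<bullet> P) \<le> - \<psi> x * (\<kappa> \<bullet> P)"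
    using \<kappa>P by (rule mult_right_mono)
  moreover have "C * (1 - x) * V x * \<kappa> $ i \<ge> 0" using CV \<kappa>(2) by (simp add: less_imp_le)
  ultimately show "- v P $ i \<le> - M1_tilde \<psi> \<kappa> P"
    unfolding v x_def[symmetric] M1_tilde_def by (simp add: right_diff_distrib)
qed

lemma mlb_M2_bdd_above:
  assumes model: "mlb_model m v M2 w \<kappa> \<psi>" and m: "m > 0"
    and w: "pw_derivative m w w'" "mono_on {0..m} w'" "\<forall>x\<in>{0..m}. w x \<ge> 0" "w m = 0"
    and \<kappa>: "antimono (($) \<kappa>)" "\<forall>i. \<kappa> $ i > 0"
  shows "bdd_above (M2 ` inv_region m)"
proof -
  obtain C V where V: "continuous_on {0..m} V" "\<And>x. x \<in> {0..m} \<Longrightarrow> V x \<ge> 0"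
    and v: "\<And>P i. P \<in> inv_region m \<Longrightarrow>
      v P $ i = C * (1 - total_conc P) * V (total_conc P) * (\<kappa> $ i - \<kappa> \<bullet> P)"
    and M2: "\<And>P. P \<in> inv_region m \<Longrightarrow> M2 P = v P $ first_ix"
    and C: "C \<ge> 0" "C = 0 \<or> m \<le> 1"
    using mlb_coefficient_nonneg[OF model m w] by metis
  \<comment> \<open>Discarding the nonnegative inner product of kappa and P from the first velocity
    leaves a majorant of \<open>M2\<close> that depends continuously on the total concentration
    alone.\<close>
  define h where "h x = C * (1 - x) * V x * \<kappa> $ first_ix" for x
  have "bdd_above (h ` {0..m})" unfolding h_def
    by (intro bounded_imp_bdd_above compact_imp_bounded compact_continuous_image
        continuous_intros V) auto
  then obtain B where "\<forall>y\<in>h ` {0..m}. y \<le> B" unfolding bdd_above_def by blast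
  then have B: "\<And>x. x \<in> {0..m} \<Longrightarrow> h x \<le> B" by blast
  have "M2 P \<le> B" if P: "P \<in> inv_region m" for P
  proof -
    note x = total_conc_inv_region[OF P]
    have "C * (1 - total_conc P) * V (total_conc P) \<ge> 0"
      using C V(2)[OF x] x by (auto intro: mult_nonneg_nonneg)
    then have "M2 P \<le> h (total_conc P)"
      unfolding M2[OF P] v[OF P] h_def
      using inner_inv_region_bounds(1)[OF \<kappa> P] by (intro mult_left_mono) auto
    then show ?thesis using B[OF x] by linarith
  qed
  then show ?thesis by (rule bdd_aboveI2)
qed

section \<open>Interface viscosity and admissible states\<close>

lemma segment_in_inv_region:
  assumes "P \<in> inv_region m" "Q \<in> inv_region m" "s \<in> {0..1}"
  shows "s *\<^sub>R Q + (1 - s) *\<^sub>R P \<in> inv_region m"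
  using assms by (intro convexD[OF convex_inv_region]) auto

text \<open>Both interface states lie on the segment, at s = 0 and s = 1. Boundedness on the region
  makes the infimum and supremum over the segment genuine bounds.\<close>

lemma viscosity_ge:
  fixes P Q :: "real ^ 'n"
  assumes PQ: "P \<in> inv_region m" "Q \<in> inv_region m" and R: "R \<in> {P, Q}"
    and M1: "bdd_below (M1 ` inv_region m)" and M2: "bdd_above (M2 ` inv_region m)"
  shows "- M1 R \<le> viscosity M1 M2 P Q" "M2 R \<le> viscosity M1 M2 P Q"
proof -
  define seg where "seg s = s *\<^sub>R Q + (1 - s) *\<^sub>R P" for s
  have seg: "seg ` {0..1} \<subseteq> inv_region m"
    using segment_in_inv_region[OF PQ] by (auto simp: seg_def)
  have "R = seg 0 \<or> R = seg 1" using R by (auto simp: seg_def)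
  then obtain s where s: "s \<in> {0..1}" "R = seg s"
    by (metis atLeastAtMost_iff order_refl zero_le_one)
  have "bdd_below ((\<lambda>s. M1 (seg s)) ` {0..1})"
    by (rule bdd_below_mono[OF M1]) (use seg in blast)
  then have "S_L M1 P Q \<le> M1 R"
    unfolding S_L_def seg_def[symmetric] s(2) by (rule cINF_lower) (rule s)
  then show "- M1 R \<le> viscosity M1 M2 P Q" by (simp add: viscosity_def)
  have "bdd_above ((\<lambda>s. M2 (seg s)) ` {0..1})"
    by (rule bdd_above_mono[OF M2]) (use seg in blast)
  then have "M2 R \<le> S_R M2 P Q"
    unfolding S_R_def seg_def[symmetric] s(2) by (rule cSUP_upper[rotated]) (rule s)
  then show "M2 R \<le> viscosity M1 M2 P Q" by (simp add: viscosity_def)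
qed

text \<open>The components are P_i (a + v_i) and P_i (a - v_i), both nonnegative. For the plus sign
  the total is controlled by the upper bound on the total flux, for the minus sign by its
  nonnegativity.\<close>

lemma scaled_state_flux_in_inv_region:
  assumes P: "P \<in> inv_region m" and v: "\<And>i. \<bar>v P $ i\<bar> \<le> a"
    and total: "0 \<le> total_conc (flux v P)" "total_conc (flux v P) \<le> a * (m - total_conc P)"
    and a: "0 \<le> a"
  shows "a *\<^sub>R P + flux v P \<in> inv_region (a * m)" "a *\<^sub>R P - flux v P \<in> inv_region (a * m)"
proof -
  have "0 \<le> P $ i * (a + v P $ i)" "0 \<le> P $ i * (a - v P $ i)" for i
    using v[of i] P by (auto simp: inv_region_def abs_le_iff)
  moreover have "a * total_conc P \<le> a * m"
    using P a by (simp add: inv_region_def mult_left_mono)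
  ultimately show "a *\<^sub>R P + flux v P \<in> inv_region (a * m)"
    "a *\<^sub>R P - flux v P \<in> inv_region (a * m)"
    using total by (simp_all add: inv_region_def total_conc_add total_conc_diff
        total_conc_scaleR flux_def algebra_simps)
qed

section \<open>The update of one cell\<close>

text \<open>Here Q and Q' are the contributions of the right and left neighbours, carrying the
  scales a and a' of the two interfaces. The terms in f cancel, and the weights c, l a / 2 and l a'
  / 2 sum to 1.\<close>

lemma cell_update_in_inv_region:
  fixes P :: "real ^ 'n"
  assumes P: "P \<in> inv_region m"
    and R: "Q \<in> inv_region (a * m)" "l * a \<le> 1" "FR = (1 / 2) *\<^sub>R (f + a *\<^sub>R P - Q)"
    and L: "Q' \<in> inv_region (a' * m)" "l * a' \<le> 1" "FL = (1 / 2) *\<^sub>R (f - a' *\<^sub>R P + Q')"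
    and l: "0 \<le> l"
  shows "P - l *\<^sub>R (FR - FL) \<in> inv_region m"
proof -
  \<comment> \<open>This is the weight left for the old state; it is nonnegative by averaging the
    two CFL bounds.\<close>
  define c where "c = 1 - l * (a + a') / 2"
  have c: "c \<ge> 0" using R(2) L(2) by (simp add: c_def algebra_simps)
  have eq: "P - l *\<^sub>R (FR - FL) = c *\<^sub>R P + (l / 2) *\<^sub>R (Q + Q')"
    unfolding R(3) L(3) c_def by (simp add: vec_eq_iff field_simps)
  have "total_conc (P - l *\<^sub>R (FR - FL)) = c * total_conc P + l / 2 * (total_conc Q + total_conc Q')"
    unfolding eq by (simp only: total_conc_add total_conc_scaleR)
  also have "\<dots> \<le> c * m + l / 2 * (a * m + a' * m)"
    using P R(1) L(1) c l
    by (intro add_mono mult_left_mono) (auto simp: inv_region_def)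
  also have "\<dots> = m" by (simp add: c_def field_simps)
  finally show ?thesis
    unfolding inv_region_def eq using P R(1) L(1) c l by (simp add: inv_region_def)
qed

lemma finite_llf_interfaces: "finite (llf_interfaces bc M)"
  by (cases bc) (auto simp: llf_interfaces_def)

lemma viscosity_le_max_speed:
  assumes "k \<in> llf_interfaces bc M"
  shows "viscosity M1 M2 (U (left_cell M k)) (U (right_cell M k)) \<le> max_speed bc M M1 M2 U"
  unfolding max_speed_def
  by (rule Max_ge) (use assms finite_llf_interfaces in auto)

lemma left_cell_less: "k \<le> M \<Longrightarrow> M > 0 \<Longrightarrow> left_cell M k < M"
  by (auto simp: left_cell_def)

lemma right_cell_less: "k \<le> M \<Longrightarrow> M > 0 \<Longrightarrow> right_cell M k < M"
  by (auto simp: right_cell_def)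

text \<open>At a wall, the zero flux has the same form as the LLF flux: the missing neighbour
  contributes the reflected flux of the cell itself.\<close>
lemma llf_step_in_inv_region:
  fixes U :: "nat \<Rightarrow> real ^ 'n"
  assumes U: "\<And>j. j < M \<Longrightarrow> U j \<in> inv_region m" and j: "j < M" and l: "0 \<le> l"
    and cfl: "l * max_speed bc M M1 M2 U \<le> 1"
    and adm: "\<And>P Q R a. P \<in> inv_region m \<Longrightarrow> Q \<in> inv_region m \<Longrightarrow> R \<in> {P, Q} \<Longrightarrow>
      viscosity M1 M2 P Q \<le> a \<Longrightarrow>
      a *\<^sub>R R + f R \<in> inv_region (a * m) \<and> a *\<^sub>R R - f R \<in> inv_region (a * m)"
  shows "U j - l *\<^sub>R (interface_flux bc M f M1 M2 U (Suc j) - interface_flux bc M f M1 M2 U j)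
    \<in> inv_region m"
\<comment> \<open>A single cell between two walls touches no LLF interface: both fluxes vanish and
  the state is unchanged.\<close>
proof (cases "bc = Zero_Flux \<and> M = 1")
  case True
  then show ?thesis using U[OF j] j by (simp add: interface_flux_def llf_interfaces_def)
next
  case False
  define A where "A = max_speed bc M M1 M2 U"
  define F where "F = interface_flux bc M f M1 M2 U"
  define a where "a k = viscosity M1 M2 (U (left_cell M k)) (U (right_cell M k))" for k
  have aA: "a k \<le> A" if "k \<in> llf_interfaces bc M" for k
    unfolding a_def A_def by (rule viscosity_le_max_speed[OF that])
  have la: "l * a k \<le> 1" if "k \<in> llf_interfaces bc M" for k
    using mult_left_mono[OF aA[OF that] l] cfl by (simp add: A_def)
  have kM: "k \<le> M" if "k \<in> llf_interfaces bc M" for k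
    using that by (cases bc) (auto simp: llf_interfaces_def)
  \<comment> \<open>The scale b may exceed the local viscosity, so that the global speed A can be
    used at walls.\<close>
  have adm_k: "b *\<^sub>R R + f R \<in> inv_region (b * m) \<and> b *\<^sub>R R - f R \<in> inv_region (b * m)"
    if "k \<in> llf_interfaces bc M" "a k \<le> b" "R \<in> {U (left_cell M k), U (right_cell M k)}" for k b R
    using adm[OF U U that(3)] that(2) left_cell_less right_cell_less kM[OF that(1)] j
    by (auto simp: a_def)
  \<comment> \<open>Interface j bounds cell j on the left and \<open>Suc j\<close> bounds it on the
    right; periodic wrapping affects only the outer neighbours.\<close>
  have cells: "left_cell M (Suc j) = j" "right_cell M j = j"
    using j by (auto simp: left_cell_def right_cell_def)
  have touch: "j \<in> llf_interfaces bc M \<or> Suc j \<in> llf_interfaces bc M"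
    using False j by (cases bc) (auto simp: llf_interfaces_def)
  \<comment> \<open>A wall has no viscosity of its own. The cell's other interface is of LLF type,
    and A dominates its viscosity.\<close>
  have wall: "A *\<^sub>R U j + f (U j) \<in> inv_region (A * m) \<and> A *\<^sub>R U j - f (U j) \<in> inv_region (A * m)"
    using touch adm_k[OF _ aA] cells by (metis insertCI)
  have "\<exists>Q b. Q \<in> inv_region (b * m) \<and> l * b \<le> 1 \<and>
      F (Suc j) = (1 / 2) *\<^sub>R (f (U j) + b *\<^sub>R U j - Q)"
  proof (cases "Suc j \<in> llf_interfaces bc M")
    case True
    define r where "r = U (right_cell M (Suc j))"
    have "F (Suc j) = (1 / 2) *\<^sub>R (f (U j) + a (Suc j) *\<^sub>R U j - (a (Suc j) *\<^sub>R r - f r))"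
      using True by (simp add: F_def interface_flux_def llf_flux_def cells a_def r_def algebra_simps)
    moreover have "a (Suc j) *\<^sub>R r - f r \<in> inv_region (a (Suc j) * m)"
      using adm_k[OF True order_refl] by (simp add: r_def)
    ultimately show ?thesis using la[OF True] by blast
  next
    case False
    \<comment> \<open>The right-hand side is zero: the missing neighbour is given the state
      \<open>U j\<close> and the flux -f(U j).\<close>
    then have "F (Suc j) = (1 / 2) *\<^sub>R (f (U j) + A *\<^sub>R U j - (A *\<^sub>R U j + f (U j)))"
      by (simp add: F_def interface_flux_def)
    then show ?thesis using wall cfl A_def by blast
  qed
  then obtain Q b where R: "Q \<in> inv_region (b * m)" "l * b \<le> 1"
    "F (Suc j) = (1 / 2) *\<^sub>R (f (U j) + b *\<^sub>R U j - Q)" by blast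
  have "\<exists>Q b. Q \<in> inv_region (b * m) \<and> l * b \<le> 1 \<and>
      F j = (1 / 2) *\<^sub>R (f (U j) - b *\<^sub>R U j + Q)"
  proof (cases "j \<in> llf_interfaces bc M")
    case True
    define r where "r = U (left_cell M j)"
    have "F j = (1 / 2) *\<^sub>R (f (U j) - a j *\<^sub>R U j + (a j *\<^sub>R r + f r))"
      using True by (simp add: F_def interface_flux_def llf_flux_def cells a_def r_def algebra_simps)
    moreover have "a j *\<^sub>R r + f r \<in> inv_region (a j * m)"
      using adm_k[OF True order_refl] by (simp add: r_def)
    ultimately show ?thesis using la[OF True] by blast
  next
    case False
    then have "F j = (1 / 2) *\<^sub>R (f (U j) - A *\<^sub>R U j + (A *\<^sub>R U j - f (U j)))"
      by (simp add: F_def interface_flux_def)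
    then show ?thesis using wall cfl A_def by blast
  qed
  then obtain Q' b' where L: "Q' \<in> inv_region (b' * m)" "l * b' \<le> 1"
    "F j = (1 / 2) *\<^sub>R (f (U j) - b' *\<^sub>R U j + Q')" by blast
  show ?thesis
    unfolding F_def[symmetric] by (rule cell_update_in_inv_region[OF U[OF j] R L l])
qed

section \<open>Admissibility from (W1)--(W5) and preservation of the region under the CFL
  condition\<close>

theorem theorem1:
  fixes \<phi>max L :: real
    and v :: "real ^ 'n::{finite,linorder} \<Rightarrow> real ^ 'n::{finite,linorder}"
    and lam :: "real ^ 'n::{finite,linorder} \<Rightarrow> real ^ 'n::{finite,linorder}"
    and w w' \<psi> :: "real \<Rightarrow> real"
    and \<kappa> :: "real ^ 'n::{finite,linorder}"
    and M2 :: "real ^ 'n::{finite,linorder} \<Rightarrow> real"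
    and bc :: boundary
    and M N\<^sub>T :: nat
    and \<Delta>t :: "nat \<Rightarrow> real"
    and \<Phi> :: "nat \<Rightarrow> nat \<Rightarrow> real ^ 'n::{finite,linorder}"
  assumes phimax: "\<phi>max > 0"
    and hyp: "hyperbolic_with_eigenvalues (inv_region \<phi>max) (flux v) lam"
    and W1_diff: "pw_derivative \<phi>max w w'"
    and W1_kappa: "antimono (($) \<kappa>)" "\<forall>i. \<kappa> $ i > 0"
    and W1_sum: "\<forall>P\<in>inv_region \<phi>max. (\<Sum>i\<in>UNIV. P $ i * v P $ i) = w (total_conc P) * (\<kappa> \<bullet> P)"
    and W2: "\<forall>x\<in>{0..\<phi>max}. w x \<ge> 0"
    and W3: "w \<phi>max = 0"
    and W4: "\<forall>x y. 0 \<le> x \<and> x \<le> y \<and> y \<le> \<phi>max \<longrightarrow> w' x \<le> w' y"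
    and W5_psi: "pw_continuous \<phi>max \<psi>"
    and W5: "\<forall>P\<in>inv_region \<phi>max.
               \<psi> (total_conc P) * (\<kappa> \<bullet> P) \<le> lam P $ last_ix \<and> w' (total_conc P) \<ge> \<psi> (total_conc P)"
    and model: "mclwr_model \<phi>max v M2 w \<kappa> \<psi> \<or> mlb_model \<phi>max v M2 w \<kappa> \<psi>"
    and grid: "L > 0" "M > 0" "\<forall>n<N\<^sub>T. \<Delta>t n > 0"
    and scheme: "\<forall>n<N\<^sub>T. \<forall>j<M.
      \<Phi> (Suc n) j = \<Phi> n j - (\<Delta>t n / (L / real M)) *\<^sub>R
        (interface_flux bc M (flux v) (M1_tilde \<psi> \<kappa>) M2 (\<Phi> n) (Suc j)
         - interface_flux bc M (flux v) (M1_tilde \<psi> \<kappa>) M2 (\<Phi> n) j)"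
    and CFL: "\<forall>n<N\<^sub>T. max_speed bc M (M1_tilde \<psi> \<kappa>) M2 (\<Phi> n) * (\<Delta>t n / (L / real M)) \<le> 1"
  shows "\<forall>n<N\<^sub>T. (\<forall>j<M. \<Phi> n j \<in> inv_region \<phi>max) \<longrightarrow> (\<forall>j<M. \<Phi> (Suc n) j \<in> inv_region \<phi>max)"
proof (intro allI impI)
  fix n j assume n: "n < N\<^sub>T" and U: "\<forall>j<M. \<Phi> n j \<in> inv_region \<phi>max" and j: "j < M"
  let ?M1 = "M1_tilde \<psi> \<kappa>"
  define l where "l = \<Delta>t n / (L / real M)"
  have l: "0 \<le> l" using grid n by (auto simp: l_def less_imp_le)
  have mono: "mono_on {0..\<phi>max} w'" using W4 by (auto intro: mono_onI)
  obtain B where B: "\<And>x. x \<in> {0..\<phi>max} \<Longrightarrow> \<bar>\<psi> x\<bar> \<le> B"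
    using pw_continuous_bounded[OF W5_psi] by blast
  have "- (B * (\<kappa> $ first_ix * \<phi>max)) \<le> ?M1 P" if P: "P \<in> inv_region \<phi>max" for P
  proof -
    have "\<bar>?M1 P\<bar> \<le> B * (\<kappa> $ first_ix * \<phi>max)"
      unfolding M1_tilde_def abs_mult
      using inner_inv_region_bounds[OF W1_kappa P] B[OF total_conc_inv_region[OF P]]
      by (intro mult_mono) auto
    then show ?thesis by (simp add: abs_le_iff)
  qed
  then have M1: "bdd_below (?M1 ` inv_region \<phi>max)" by (rule bdd_belowI2)
  have M2: "bdd_above (M2 ` inv_region \<phi>max)"
    using model by (elim disjE mclwr_M2_bdd_above
        mlb_M2_bdd_above[OF _ phimax W1_diff mono W2 W3 W1_kappa])
  have adm: "a *\<^sub>R R + flux v R \<in> inv_region (a * \<phi>max) \<and>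
      a *\<^sub>R R - flux v R \<in> inv_region (a * \<phi>max)"
    if PQ: "P \<in> inv_region \<phi>max" "Q \<in> inv_region \<phi>max" and RPQ: "R \<in> {P, Q}"
      and a: "viscosity ?M1 M2 P Q \<le> a" for P Q R a
  proof -
    have R: "R \<in> inv_region \<phi>max" using PQ RPQ by blast
    have a0: "0 \<le> a" using a by (simp add: viscosity_def max_def split: if_splits)
    have speed: "- ?M1 R \<le> a" "M2 R \<le> a"
      using viscosity_ge[OF PQ RPQ M1 M2] a by linarith+
    \<comment> \<open>The MCLWR model supplies the first alternative and the MLB model the second;
      with the speed bounds either one gives modulus at most a.\<close>
    have "v R $ i \<le> M2 R \<and> (0 \<le> v R $ i \<or> - v R $ i \<le> - ?M1 R)" for i
      using model
    proof
      assume "mclwr_model \<phi>max v M2 w \<kappa> \<psi>"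
      from mclwr_velocity_bounds[OF this R] show ?thesis by blast
    next
      assume "mlb_model \<phi>max v M2 w \<kappa> \<psi>"
      from mlb_velocity_bounds[OF this phimax W1_diff mono W2 W3 R W1_kappa] show ?thesis by blast
    qed
    then have v: "\<bar>v R $ i\<bar> \<le> a" for i
      using speed a0 by (smt (verit))
    have x: "total_conc R \<in> {0..\<phi>max}" by (rule total_conc_inv_region[OF R])
    have \<kappa>R: "\<kappa> \<bullet> R \<ge> 0" by (rule inner_inv_region_bounds(1)[OF W1_kappa R])
    have total: "total_conc (flux v R) = w (total_conc R) * (\<kappa> \<bullet> R)"
      using W1_sum R by (simp add: total_conc_def flux_def)
    \<comment> \<open>By (W5), psi lies below \<open>w'\<close>; the tangent inequality from the
      total concentration to phi_max, where w vanishes, then bounds w. Multiplying by the inner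
      product of kappa and R turns psi into \<open>M1_tilde\<close>, whose negative is at most
      a.\<close>
    have "(\<phi>max - total_conc R) * \<psi> (total_conc R) \<le> (\<phi>max - total_conc R) * w' (total_conc R)"
      using W5 R x by (intro mult_left_mono) auto
    also have "\<dots> \<le> - w (total_conc R)"
      using pw_derivative_mono_bounds(1)[OF W1_diff mono, of "total_conc R" \<phi>max] x W3 by simp
    finally have "w (total_conc R) * (\<kappa> \<bullet> R) \<le>
        - ((\<phi>max - total_conc R) * \<psi> (total_conc R)) * (\<kappa> \<bullet> R)"
      using \<kappa>R by (intro mult_right_mono) auto
    also have "\<dots> = (\<phi>max - total_conc R) * - ?M1 R"
      by (simp add: M1_tilde_def)
    also have "\<dots> \<le> (\<phi>max - total_conc R) * a"
      using speed x by (intro mult_left_mono) auto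
    finally have "total_conc (flux v R) \<le> a * (\<phi>max - total_conc R)"
      by (simp add: total mult.commute)
    moreover have "0 \<le> total_conc (flux v R)"
      unfolding total using W2 x \<kappa>R by (intro mult_nonneg_nonneg) auto
    ultimately show ?thesis
      using scaled_state_flux_in_inv_region[of R \<phi>max v a, OF R v] a0 by blast
  qed
  have "l * max_speed bc M ?M1 M2 (\<Phi> n) \<le> 1"
    using CFL n by (simp add: l_def mult.commute)
  from llf_step_in_inv_region[OF _ j l this adm] U
  show "\<Phi> (Suc n) j \<in> inv_region \<phi>max"
    using scheme n j by (simp add: l_def)
qed

end
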